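(* Let $r\ge 1$, $s\ge 2$ and $n=rs$. Then $\chi_{la}(G_1(r,s))=3$ and $\chi_{la}(G_2(r,s))=3$.
   Context: For a graph $G=(V,E)$ with $|E|=m$ and no isolated vertices, a local antimagic labeling is a bijection $f:E\to\{1,\dots,m\}$ such that $f^+(u)\ne f^+(v)$ for every edge $uv$, where $f^+(x)=\sum f(e)$ over all edges $e$ incident to $x$. The local antimagic chromatic number $\chi_{la}(G)$ is the minimum, over all local antimagic labelings $f$ of $G$, of the number of distinct values taken by $f^+$ (also for disconnected graphs). Merging a set of vertices means identifying them into one vertex incident to all edges previously incident to any of them. Take $n$ disjoint copies of $C_4(8,2)$ indexed $a=1,\dots,n$, the $a$-th copy having vertices $\{u_{a,i},v_{a,i}:1\le i\le 8\}$ and edges $u_{a,i}u_{a,i+1}$, $v_{a,i}v_{a,i+1}$ ($1\le i\le 8$, second index mod 8) and $u_{a,2j}v_{a,2j}$ ($1\le j\le 4$). $G_1(r,s)$ is obtained by merging, for each $b\in[1,r]$ and each $j\in[1,4]$, the set $\{u_{(b-1)s+i,2j-1}:1\le i\le s\}$ into one vertex and the set $\{v_{(b-1)s+i,2j-1}:1\le i\le s\}$ into one vertex. $G_2(r,s)$ is obtained by merging, for each $b\in[1,r]$, the set $\{u_{(b-1)s+i,2j}:1\le i\le s\}$ into one vertex for each $j\in\{1,4\}$, and the set $\{v_{(b-1)s+i,2j}:1\le i\le s\}$ into one vertex for each $j\in\{2,3\}$. *)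

theory Defs
  imports "HOL-Library.Extended_Nat" "HOL-Library.Disjoint_Sets"
begin

section \<open>Graphs\<close>

text \<open>
  Edges carry their own identity and an end map, so that identifying vertices leaves the edge
  set untouched and can never collapse two edges into one.
\<close>

record ('v, 'e) graph =
  verts :: "'v set"
  edges :: "'e set"
  ends :: "'e \<Rightarrow> 'v set"

definition simple_graph :: "('v, 'e) graph \<Rightarrow> bool" where
  "simple_graph G \<longleftrightarrow> finite (verts G) \<and> finite (edges G) \<and>
     (\<forall>e\<in>edges G. ends G e \<subseteq> verts G \<and> card (ends G e) = 2) \<and> inj_on (ends G) (edges G)"

definition no_isolated_vertices :: "('v, 'e) graph \<Rightarrow> bool" where
  "no_isolated_vertices G \<longleftrightarrow> (\<forall>x\<in>verts G. \<exists>e\<in>edges G. x \<in> ends G e)"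


section \<open>Local antimagic labelings\<close>

definition vertex_sum :: "('v, 'e) graph \<Rightarrow> ('e \<Rightarrow> nat) \<Rightarrow> 'v \<Rightarrow> nat" where
  "vertex_sum G f x = (\<Sum>e | e \<in> edges G \<and> x \<in> ends G e. f e)"

definition local_antimagic :: "('v, 'e) graph \<Rightarrow> ('e \<Rightarrow> nat) \<Rightarrow> bool" where
  "local_antimagic G f \<longleftrightarrow> bij_betw f (edges G) {1..card (edges G)} \<and>
     (\<forall>e\<in>edges G. \<forall>u v. ends G e = {u, v} \<longrightarrow> vertex_sum G f u \<noteq> vertex_sum G f v)"

text \<open>
  The infimum is taken in \<^typ>\<open>enat\<close>: it is a minimum as soon as a local antimagic labeling
  exists, and infinity (rather than some natural number) otherwise.
\<close>

definition local_antimagic_chromatic_number :: "('v, 'e) graph \<Rightarrow> enat"  ("\<chi>\<^sub>l\<^sub>a") where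
  "\<chi>\<^sub>l\<^sub>a G = (INF f \<in> {f. local_antimagic G f}. enat (card (vertex_sum G f ` verts G)))"


section \<open>Merging\<close>

text \<open>
  \<open>merge P G\<close> identifies, for every set in the family \<open>P\<close> of disjoint sets of vertices, all
  vertices of this set.  A vertex of the result is represented by the set of the original
  vertices it stems from.
\<close>

definition merge_class :: "'v set set \<Rightarrow> 'v \<Rightarrow> 'v set" where
  "merge_class P x = insert x (\<Union>{X \<in> P. x \<in> X})"

definition merge :: "'v set set \<Rightarrow> ('v, 'e) graph \<Rightarrow> ('v set, 'e) graph" where
  "merge P G = \<lparr>verts = merge_class P ` verts G, edges = edges G,
     ends = (\<lambda>e. merge_class P ` ends G e)\<rparr>"


section \<open>The graphs $G_1(r,s)$ and $G_2(r,s)$\<close>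

text \<open>\<open>U a i\<close> and \<open>V a i\<close> are $u_{a,i}$ and $v_{a,i}$; both indices start at 1.\<close>

datatype vertex = U nat nat | V nat nat

definition succ8 :: "nat \<Rightarrow> nat" where
  "succ8 i = i mod 8 + 1"

definition copies_C4_8_2 :: "nat \<Rightarrow> (vertex, vertex set) graph" where
  "copies_C4_8_2 n = \<lparr>
     verts = {U a i | a i. a \<in> {1..n} \<and> i \<in> {1..8}} \<union> {V a i | a i. a \<in> {1..n} \<and> i \<in> {1..8}},
     edges = {{U a i, U a (succ8 i)} | a i. a \<in> {1..n} \<and> i \<in> {1..8}}
           \<union> {{V a i, V a (succ8 i)} | a i. a \<in> {1..n} \<and> i \<in> {1..8}}
           \<union> {{U a (2 * j), V a (2 * j)} | a j. a \<in> {1..n} \<and> j \<in> {1..4}},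
     ends = (\<lambda>e. e)\<rparr>"

definition merged_sets1 :: "nat \<Rightarrow> nat \<Rightarrow> vertex set set" where
  "merged_sets1 r s =
     {{U ((b - 1) * s + i) (2 * j - 1) | i. i \<in> {1..s}} | b j. b \<in> {1..r} \<and> j \<in> {1..4}}
   \<union> {{V ((b - 1) * s + i) (2 * j - 1) | i. i \<in> {1..s}} | b j. b \<in> {1..r} \<and> j \<in> {1..4}}"

definition merged_sets2 :: "nat \<Rightarrow> nat \<Rightarrow> vertex set set" where
  "merged_sets2 r s =
     {{U ((b - 1) * s + i) (2 * j) | i. i \<in> {1..s}} | b j. b \<in> {1..r} \<and> j \<in> {1, 4}}
   \<union> {{V ((b - 1) * s + i) (2 * j) | i. i \<in> {1..s}} | b j. b \<in> {1..r} \<and> j \<in> {2, 3}}"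

definition G1 :: "nat \<Rightarrow> nat \<Rightarrow> (vertex set, vertex set) graph" where
  "G1 r s = merge (merged_sets1 r s) (copies_C4_8_2 (r * s))"

definition G2 :: "nat \<Rightarrow> nat \<Rightarrow> (vertex set, vertex set) graph" where
  "G2 r s = merge (merged_sets2 r s) (copies_C4_8_2 (r * s))"


section \<open>The standing assumptions hold\<close>

lemma merge_class_in:
  assumes "disjoint P" "X \<in> P" "x \<in> X"
  shows "merge_class P x = X"
  using assms unfolding merge_class_def disjoint_def by blast

lemma merge_class_notin: "x \<notin> \<Union>P \<Longrightarrow> merge_class P x = {x}"
  unfolding merge_class_def by blast

lemma merge_class_eq:
  assumes "disjoint P" "merge_class P x = merge_class P y"
  shows "x = y \<or> (\<exists>X\<in>P. x \<in> X \<and> y \<in> X)"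
proof (cases "x \<in> \<Union>P")
  case True
  then obtain X where X: "X \<in> P" "x \<in> X" by blast
  then have "y \<in> X"
    using merge_class_in[OF assms(1) X] assms(2) by (auto simp: merge_class_def)
  with X show ?thesis by blast
next
  case False
  then have "y = x"
    using merge_class_notin[OF False] assms(2) by (auto simp: merge_class_def)
  then show ?thesis by simp
qed

lemma no_isolated_vertices_merge:
  "no_isolated_vertices G \<Longrightarrow> no_isolated_vertices (merge P G)"
  unfolding no_isolated_vertices_def merge_def by fastforce

lemma simple_graph_merge:
  assumes simple: "simple_graph G" and disj: "disjoint P"
    and one: "\<And>e x y. e \<in> edges G \<Longrightarrow> ends G e = {x, y} \<Longrightarrow> x \<noteq> y \<Longrightarrow> x \<in> \<Union>P \<Longrightarrow> y \<notin> \<Union>P"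
    and common: "\<And>e e' x x' y X. e \<in> edges G \<Longrightarrow> e' \<in> edges G \<Longrightarrow> ends G e = {x, y} \<Longrightarrow>
      ends G e' = {x', y} \<Longrightarrow> X \<in> P \<Longrightarrow> x \<in> X \<Longrightarrow> x' \<in> X \<Longrightarrow> x = x'"
  shows "simple_graph (merge P G)"
proof -
  have pair: "\<exists>x y. ends G e = {x, y} \<and> x \<noteq> y" if "e \<in> edges G" for e
  proof -
    have "card (ends G e) = 2" using simple that unfolding simple_graph_def by blast
    then show ?thesis unfolding card_2_iff .
  qed
  have neq: "merge_class P x \<noteq> merge_class P y"
    if "e \<in> edges G" "ends G e = {x, y}" "x \<noteq> y" for e x y
    using merge_class_eq[OF disj] one[OF that] that(3) by blast
  have key: "{x, y} = {x', y'}"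
    if e: "e \<in> edges G" "ends G e = {x, y}" "x \<noteq> y"
      and e': "e' \<in> edges G" "ends G e' = {x', y'}" "x' \<noteq> y'"
      and eq: "merge_class P x = merge_class P x'" "merge_class P y = merge_class P y'"
    for e e' x y x' y'
  proof -
    note x = merge_class_eq[OF disj eq(1)] and y = merge_class_eq[OF disj eq(2)]
    show ?thesis
      using x
    proof (elim disjE bexE conjE)
      assume "x = x'"
      show ?thesis
        using y
      proof (elim disjE bexE conjE)
        assume "y = y'"
        then show ?thesis using \<open>x = x'\<close> by simp
      next
        fix Y assume "Y \<in> P" "y \<in> Y" "y' \<in> Y"
        moreover have "ends G e = {y, x}" "ends G e' = {y', x}" using e e' \<open>x = x'\<close> by auto
        ultimately have "y = y'" using common[OF e(1) e'(1)] by metis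
        then show ?thesis using \<open>x = x'\<close> by simp
      qed
    next
      fix X assume X: "X \<in> P" "x \<in> X" "x' \<in> X"
      then have "y \<notin> \<Union>P" using one[OF e] by (meson UnionI)
      then have "y = y'" using y by (meson UnionI)
      moreover from this have "x = x'" using common[OF e(1) e'(1) e(2) _ X] e'(2) by simp
      ultimately show ?thesis by simp
    qed
  qed
  have inj: "inj_on (\<lambda>e. merge_class P ` ends G e) (edges G)"
  proof (rule inj_onI)
    fix e e'
    assume e: "e \<in> edges G" and e': "e' \<in> edges G"
      and eq: "merge_class P ` ends G e = merge_class P ` ends G e'"
    obtain x y where xy: "ends G e = {x, y}" "x \<noteq> y" using pair[OF e] by blast
    obtain x' y' where xy': "ends G e' = {x', y'}" "x' \<noteq> y'" using pair[OF e'] by blast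
    have yx': "ends G e' = {y', x'}" "y' \<noteq> x'" using xy' by auto
    from eq xy xy' have "{merge_class P x, merge_class P y} = {merge_class P x', merge_class P y'}"
      by simp
    then have "{x, y} = {x', y'}"
      unfolding doubleton_eq_iff[of "merge_class P x"]
    proof (elim disjE conjE)
      assume "merge_class P x = merge_class P x'" "merge_class P y = merge_class P y'"
      then show ?thesis by (rule key[OF e xy e' xy'])
    next
      assume "merge_class P x = merge_class P y'" "merge_class P y = merge_class P x'"
      then have "{x, y} = {y', x'}" by (rule key[OF e xy e' yx'])
      then show ?thesis by (simp add: insert_commute)
    qed
    then have "ends G e = ends G e'" using xy(1) xy'(1) by simp
    moreover have "inj_on (ends G) (edges G)" using simple unfolding simple_graph_def by blast
    ultimately show "e = e'" using e e' by (simp add: inj_on_eq_iff)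
  qed
  have two: "card (merge_class P ` ends G e) = 2" if e: "e \<in> edges G" for e
  proof -
    obtain x y where xy: "ends G e = {x, y}" "x \<noteq> y" using pair[OF e] by blast
    then show ?thesis using neq[OF e xy] by simp
  qed
  show ?thesis
    unfolding simple_graph_def merge_def graph.simps
  proof (intro conjI ballI)
    fix e assume e: "e \<in> edges G"
    then have "ends G e \<subseteq> verts G" using simple unfolding simple_graph_def by blast
    then show "merge_class P ` ends G e \<subseteq> merge_class P ` verts G" by (rule image_mono)
    show "card (merge_class P ` ends G e) = 2" using two[OF e] .
  qed (use simple inj in \<open>simp_all add: simple_graph_def\<close>)
qed

lemma succ8_in: "i \<in> {1..8} \<Longrightarrow> succ8 i \<in> {1..8} \<and> succ8 i \<noteq> i"
  unfolding succ8_def by (cases "i = 8") auto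

lemma parity_succ8: "even (succ8 i) \<longleftrightarrow> odd i"
  unfolding succ8_def by presburger

lemma copies_edge:
  "e \<in> edges (copies_C4_8_2 n) \<longleftrightarrow>
     (\<exists>a i. e = {U a i, U a (succ8 i)} \<and> a \<in> {1..n} \<and> i \<in> {1..8}) \<or>
     (\<exists>a i. e = {V a i, V a (succ8 i)} \<and> a \<in> {1..n} \<and> i \<in> {1..8}) \<or>
     (\<exists>a j. e = {U a (2 * j), V a (2 * j)} \<and> a \<in> {1..n} \<and> j \<in> {1..4})"
  unfolding copies_C4_8_2_def graph.simps Un_iff mem_Collect_eq by (simp only: disj_assoc)

lemma copies_verts:
  "U a i \<in> verts (copies_C4_8_2 n) \<longleftrightarrow> a \<in> {1..n} \<and> i \<in> {1..8}"
  "V a i \<in> verts (copies_C4_8_2 n) \<longleftrightarrow> a \<in> {1..n} \<and> i \<in> {1..8}"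
  unfolding copies_C4_8_2_def by simp_all

lemma copies_ends: "ends (copies_C4_8_2 n) e = e"
  unfolding copies_C4_8_2_def by simp

lemma simple_graph_copies: "simple_graph (copies_C4_8_2 n)"
proof -
  let ?A = "{1..n} \<times> {1..8::nat}"
  have v: "verts (copies_C4_8_2 n) = (\<lambda>(a, i). U a i) ` ?A \<union> (\<lambda>(a, i). V a i) ` ?A"
    unfolding copies_C4_8_2_def by auto
  have w: "ends (copies_C4_8_2 n) = (\<lambda>e. e)"
    unfolding copies_C4_8_2_def by simp
  have edge: "e \<subseteq> verts (copies_C4_8_2 n) \<and> card e = 2" if "e \<in> edges (copies_C4_8_2 n)" for e
  proof -
    consider a i where "e = {U a i, U a (succ8 i)}" "a \<in> {1..n}" "i \<in> {1..8}"
      | a i where "e = {V a i, V a (succ8 i)}" "a \<in> {1..n}" "i \<in> {1..8}"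
      | a j where "e = {U a (2 * j), V a (2 * j)}" "a \<in> {1..n}" "j \<in> {1..4}"
      using \<open>e \<in> _\<close> unfolding copies_edge by blast
    then show ?thesis
    proof cases
      case (1 a i)
      then show ?thesis using succ8_in[of i] by (auto simp: copies_verts card_2_iff)
    next
      case (2 a i)
      then show ?thesis using succ8_in[of i] by (auto simp: copies_verts card_2_iff)
    next
      case (3 a j)
      then show ?thesis by (auto simp: copies_verts card_2_iff)
    qed
  qed
  have fin: "finite (verts (copies_C4_8_2 n))"
    unfolding v by simp
  have "edges (copies_C4_8_2 n) \<subseteq> Pow (verts (copies_C4_8_2 n))"
    using edge by blast
  then have "finite (edges (copies_C4_8_2 n))"
    by (rule finite_subset) (simp add: fin)
  then show ?thesis
    using edge fin unfolding simple_graph_def w by (simp add: inj_on_def)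
qed

lemma no_isolated_vertices_copies: "no_isolated_vertices (copies_C4_8_2 n)"
  unfolding no_isolated_vertices_def copies_ends
proof
  fix x assume x: "x \<in> verts (copies_C4_8_2 n)"
  show "\<exists>e\<in>edges (copies_C4_8_2 n). x \<in> e"
  proof (cases x)
    case (U a i)
    then have "{U a i, U a (succ8 i)} \<in> edges (copies_C4_8_2 n)"
      using x unfolding copies_edge U copies_verts by blast
    then show ?thesis using U by blast
  next
    case (V a i)
    then have "{V a i, V a (succ8 i)} \<in> edges (copies_C4_8_2 n)"
      using x unfolding copies_edge V copies_verts by blast
    then show ?thesis using V by blast
  qed
qed

lemma block_index:
  fixes b b' i i' s :: nat
  assumes "(b - 1) * s + i = (b' - 1) * s + i'" "i \<in> {1..s}" "i' \<in> {1..s}" "1 \<le> b" "1 \<le> b'"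
  shows "b = b'"
proof -
  have "(b - 1) * s + (i - 1) = (b' - 1) * s + (i' - 1)" "i - 1 < s" "i' - 1 < s"
    using assms by auto
  then have "b - 1 = b' - 1"
    by (metis add.commute div_less div_mult_self3 add_0_right less_nat_zero_code not_gr_zero)
  then show ?thesis using assms by simp
qed

lemma block_bound:
  fixes b r i s :: nat
  assumes "b \<in> {1..r}" "i \<in> {1..s}"
  shows "(b - 1) * s + i \<in> {1..r * s}"
proof -
  have "(b - 1) * s + i \<le> (b - 1) * s + s" using assms by simp
  also have "\<dots> = b * s" using assms by (cases b) auto
  also have "\<dots> \<le> r * s" using assms by simp
  finally show ?thesis using assms by simp
qed

definition U_block :: "nat \<Rightarrow> nat \<Rightarrow> nat \<Rightarrow> vertex set" where
  "U_block s b k = {U ((b - 1) * s + i) k | i. i \<in> {1..s}}"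

definition V_block :: "nat \<Rightarrow> nat \<Rightarrow> nat \<Rightarrow> vertex set" where
  "V_block s b k = {V ((b - 1) * s + i) k | i. i \<in> {1..s}}"

lemma blocks_disjoint:
  "1 \<le> b \<Longrightarrow> 1 \<le> b' \<Longrightarrow> U_block s b k = U_block s b' k' \<or> U_block s b k \<inter> U_block s b' k' = {}"
  "1 \<le> b \<Longrightarrow> 1 \<le> b' \<Longrightarrow> V_block s b k = V_block s b' k' \<or> V_block s b k \<inter> V_block s b' k' = {}"
  "U_block s b k \<inter> V_block s b' k' = {}"
  "V_block s b k \<inter> U_block s b' k' = {}"
proof -
  have *: "b = b' \<and> k = k'" if "z \<in> U_block s b k" "z \<in> U_block s b' k'" "1 \<le> b" "1 \<le> b'" for z
    using that block_index[of b s _ b'] unfolding U_block_def by auto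
  then show "U_block s b k = U_block s b' k' \<or> U_block s b k \<inter> U_block s b' k' = {}"
    if "1 \<le> b" "1 \<le> b'" using that by blast
  have *: "b = b' \<and> k = k'" if "z \<in> V_block s b k" "z \<in> V_block s b' k'" "1 \<le> b" "1 \<le> b'" for z
    using that block_index[of b s _ b'] unfolding V_block_def by auto
  then show "V_block s b k = V_block s b' k' \<or> V_block s b k \<inter> V_block s b' k' = {}"
    if "1 \<le> b" "1 \<le> b'" using that by blast
qed (auto simp: U_block_def V_block_def)

lemma merged_sets1_cases:
  assumes "X \<in> merged_sets1 r s"
  shows "(\<exists>b k. 1 \<le> b \<and> odd k \<and> X = U_block s b k) \<or> (\<exists>b k. 1 \<le> b \<and> odd k \<and> X = V_block s b k)"
proof -
  have o: "odd (2 * j - 1)" if "j \<in> {1..4}" for j :: nat using that by auto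
  have b: "1 \<le> b" if "b \<in> {1..r}" for b using that by simp
  show ?thesis
    using assms unfolding merged_sets1_def U_block_def[symmetric] V_block_def[symmetric]
      Un_iff mem_Collect_eq using o b by blast
qed

lemma merged_sets2_cases:
  assumes "X \<in> merged_sets2 r s"
  shows "(\<exists>b k. 1 \<le> b \<and> k \<in> {2, 8} \<and> X = U_block s b k) \<or>
         (\<exists>b k. 1 \<le> b \<and> k \<in> {4, 6} \<and> X = V_block s b k)"
  using assms unfolding merged_sets2_def U_block_def[symmetric] V_block_def[symmetric]
    Un_iff mem_Collect_eq
proof (elim disjE exE conjE)
  fix b j assume "X = U_block s b (2 * j)" "b \<in> {1..r}" "j \<in> {1, 4}"
  then show ?thesis by (intro disjI1 exI[of _ b] exI[of _ "2 * j"]) auto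
next
  fix b j assume "X = V_block s b (2 * j)" "b \<in> {1..r}" "j \<in> {2, 3}"
  then show ?thesis by (intro disjI2 exI[of _ b] exI[of _ "2 * j"]) auto
qed

lemma disjoint_merged_sets1: "disjoint (merged_sets1 r s)"
proof (rule disjointI)
  fix X Y assume X: "X \<in> merged_sets1 r s" and Y: "Y \<in> merged_sets1 r s" and "X \<noteq> Y"
  then show "X \<inter> Y = {}"
    using merged_sets1_cases[OF X] merged_sets1_cases[OF Y] blocks_disjoint by metis
qed

lemma disjoint_merged_sets2: "disjoint (merged_sets2 r s)"
proof (rule disjointI)
  fix X Y assume X: "X \<in> merged_sets2 r s" and Y: "Y \<in> merged_sets2 r s" and "X \<noteq> Y"
  then show "X \<inter> Y = {}"
    using merged_sets2_cases[OF X] merged_sets2_cases[OF Y] blocks_disjoint by metis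
qed

lemma merged_sets1_subset: "\<Union>(merged_sets1 r s) \<subseteq> verts (copies_C4_8_2 (r * s))"
proof -
  have j: "2 * j - 1 \<in> {1..8}" if "j \<in> {1..4}" for j :: nat using that by auto
  show ?thesis
    unfolding merged_sets1_def
    by (intro subsetI) (auto simp del: atLeastAtMost_iff One_nat_def simp: copies_verts block_bound j)
qed

lemma merged_sets2_subset: "\<Union>(merged_sets2 r s) \<subseteq> verts (copies_C4_8_2 (r * s))"
proof -
  have j: "2 * j \<in> {1..8}" if "j \<in> {1, 2, 3, 4}" for j :: nat using that by auto
  show ?thesis
    unfolding merged_sets2_def
    using j[of 1] j[of 2] j[of 3] j[of 4]
    by (intro subsetI) (auto simp del: atLeastAtMost_iff One_nat_def simp: copies_verts block_bound)
qed

fun copy_of :: "vertex \<Rightarrow> nat" where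
  "copy_of (U a i) = a" | "copy_of (V a i) = a"

lemma copies_edge_cases:
  assumes "e \<in> edges (copies_C4_8_2 n)" "ends (copies_C4_8_2 n) e = {x, y}"
  shows "\<exists>a i. {x, y} = {U a i, U a (succ8 i)} \<or> {x, y} = {V a i, V a (succ8 i)} \<or>
    {x, y} = {U a i, V a i} \<and> even i"
  using assms unfolding copies_edge copies_ends by (metis dvd_triv_left)

lemma copies_edge_copy_of:
  assumes "e \<in> edges (copies_C4_8_2 n)" "ends (copies_C4_8_2 n) e = {x, y}"
  shows "copy_of x = copy_of y"
  using copies_edge_cases[OF assms] by (auto simp: doubleton_eq_iff)

lemma in_merged_sets1:
  "U a i \<in> X \<Longrightarrow> X \<in> merged_sets1 r s \<Longrightarrow> odd i"
  "V a i \<in> X \<Longrightarrow> X \<in> merged_sets1 r s \<Longrightarrow> odd i"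
  by (auto dest!: merged_sets1_cases simp: U_block_def V_block_def)

lemma in_merged_sets2:
  "U a i \<in> X \<Longrightarrow> X \<in> merged_sets2 r s \<Longrightarrow> even i \<and> i \<noteq> 4 \<and> i \<noteq> 6"
  "V a i \<in> X \<Longrightarrow> X \<in> merged_sets2 r s \<Longrightarrow> even i \<and> (i = 4 \<or> i = 6)"
  by (auto dest!: merged_sets2_cases simp: U_block_def V_block_def)

lemma simple_graph_G1: "simple_graph (G1 r s)"
  unfolding G1_def
proof (rule simple_graph_merge[OF simple_graph_copies disjoint_merged_sets1])
  fix e x y
  assume e: "e \<in> edges (copies_C4_8_2 (r * s))" "ends (copies_C4_8_2 (r * s)) e = {x, y}" "x \<noteq> y"
    and x: "x \<in> \<Union>(merged_sets1 r s)"
  show "y \<notin> \<Union>(merged_sets1 r s)"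
    using copies_edge_cases[OF e(1,2)] x
    by (auto simp: doubleton_eq_iff parity_succ8 dest!: in_merged_sets1)
next
  fix e e' x x' y X
  assume e: "e \<in> edges (copies_C4_8_2 (r * s))" "ends (copies_C4_8_2 (r * s)) e = {x, y}"
    and e': "e' \<in> edges (copies_C4_8_2 (r * s))" "ends (copies_C4_8_2 (r * s)) e' = {x', y}"
    and X: "X \<in> merged_sets1 r s" "x \<in> X" "x' \<in> X"
  have "copy_of x = copy_of x'"
    using copies_edge_copy_of[OF e] copies_edge_copy_of[OF e'] by simp
  then show "x = x'"
    using merged_sets1_cases[OF X(1)] X(2,3) by (auto simp: U_block_def V_block_def)
qed

lemma no_isolated_vertices_G1: "no_isolated_vertices (G1 r s)"
  unfolding G1_def by (rule no_isolated_vertices_merge[OF no_isolated_vertices_copies])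

lemma simple_graph_G2: "simple_graph (G2 r s)"
  unfolding G2_def
proof (rule simple_graph_merge[OF simple_graph_copies disjoint_merged_sets2])
  fix e x y
  assume e: "e \<in> edges (copies_C4_8_2 (r * s))" "ends (copies_C4_8_2 (r * s)) e = {x, y}" "x \<noteq> y"
    and x: "x \<in> \<Union>(merged_sets2 r s)"
  show "y \<notin> \<Union>(merged_sets2 r s)"
    using copies_edge_cases[OF e(1,2)] x
    by (auto simp: doubleton_eq_iff parity_succ8 dest!: in_merged_sets2)
next
  fix e e' x x' y X
  assume e: "e \<in> edges (copies_C4_8_2 (r * s))" "ends (copies_C4_8_2 (r * s)) e = {x, y}"
    and e': "e' \<in> edges (copies_C4_8_2 (r * s))" "ends (copies_C4_8_2 (r * s)) e' = {x', y}"
    and X: "X \<in> merged_sets2 r s" "x \<in> X" "x' \<in> X"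
  have "copy_of x = copy_of x'"
    using copies_edge_copy_of[OF e] copies_edge_copy_of[OF e'] by simp
  then show "x = x'"
    using merged_sets2_cases[OF X(1)] X(2,3) by (auto simp: U_block_def V_block_def)
qed

lemma no_isolated_vertices_G2: "no_isolated_vertices (G2 r s)"
  unfolding G2_def by (rule no_isolated_vertices_merge[OF no_isolated_vertices_copies])

end

theory Submission
  imports Defs
begin

text \<open>
  Lower bound: for a proper 2-colouring of either graph, exchanging the \<open>u\<close>- and the \<open>v\<close>-side
  (for $G_2$ up to a permutation of the even indices) exchanges the colour classes.  The classes
  then have the same size, which is impossible if the two colours are the vertex sums.

  Upper bound: one labeling of the $n$ disjoint copies serves both graphs.  Its vertex sums are
  $20n+1$ at odd indices, $30n+1$ at $u_2, u_8, v_4, v_6$ and $30n+2$ at $u_4, u_6, v_2, v_8$.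
  Both families of merged sets consist of $s$ vertices with equal sums, so merging multiplies one
  of the three values by $s \ge 2$, which keeps the three values distinct.
\<close>

section \<open>Vertex sums under merging\<close>

text \<open>Since the merged graph is simple, no edge of \<open>G\<close> has both ends in one
  class. Hence the edges at a merged vertex are the disjoint union of the edges at its members, and
  the sums add up.\<close>

lemma vertex_sum_merge:
  assumes disj: "disjoint P" and sub: "\<Union>P \<subseteq> verts G" and x: "x \<in> verts G"
    and G: "simple_graph G" and M: "simple_graph (merge P G)"
  shows "vertex_sum (merge P G) f (merge_class P x) = (\<Sum>y\<in>merge_class P x. vertex_sum G f y)"
proof -
  let ?C = "merge_class P"
  have eq: "?C y = ?C x \<longleftrightarrow> y \<in> ?C x" for y
  proof
    assume "?C y = ?C x"
    then show "y \<in> ?C x" by (metis insertI1 merge_class_def)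
  next
    assume y: "y \<in> ?C x"
    show "?C y = ?C x"
    proof (cases "y = x")
      case False
      then obtain X where "X \<in> P" "x \<in> X" "y \<in> X" using y unfolding merge_class_def by blast
      then show ?thesis using merge_class_in[OF disj] by metis
    qed simp
  qed
  have fin: "finite (?C x)"
  proof -
    have "?C x \<subseteq> verts G" using sub x unfolding merge_class_def by blast
    then show ?thesis using G finite_subset unfolding simple_graph_def by blast
  qed
  have inj: "inj_on ?C (ends G e)" if "e \<in> edges G" for e
  proof (rule eq_card_imp_inj_on)
    have e: "card (ends G e) = 2" using G that unfolding simple_graph_def by blast
    \<comment> \<open>Infinite sets have cardinality 0, so cardinality 2 forces finiteness.\<close>
    then show "finite (ends G e)" by (metis card.infinite zero_neq_numeral)
    have "card (?C ` ends G e) = 2" using M that unfolding simple_graph_def merge_def by simp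
    then show "card (?C ` ends G e) = card (ends G e)" using e by simp
  qed
  have finE: "finite (edges G)" using G unfolding simple_graph_def by blast
  have "{e \<in> edges (merge P G). ?C x \<in> ends (merge P G) e}
      = (\<Union>y\<in>?C x. {e \<in> edges G. y \<in> ends G e})"
    unfolding merge_def using eq by (auto simp: image_iff)
  moreover have "(\<Sum>e\<in>(\<Union>y\<in>?C x. {e \<in> edges G. y \<in> ends G e}). f e)
      = (\<Sum>y\<in>?C x. \<Sum>e | e \<in> edges G \<and> y \<in> ends G e. f e)"
  proof (rule sum.UNION_disjoint[OF fin])
    show "\<forall>i\<in>?C x. finite {e \<in> edges G. i \<in> ends G e}" using finE by simp
    show "\<forall>i\<in>?C x. \<forall>j\<in>?C x. i \<noteq> j \<longrightarrow>
        {e \<in> edges G. i \<in> ends G e} \<inter> {e \<in> edges G. j \<in> ends G e} = {}"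
    proof (intro ballI impI)
      fix i j assume ij: "i \<in> ?C x" "j \<in> ?C x" "i \<noteq> j"
      \<comment> \<open>An edge at both \<open>i\<close> and \<open>j\<close> would contradict
        injectivity of the class map on its ends.\<close>
      then have "?C i = ?C j" using eq[of i] eq[of j] by simp
      then show "{e \<in> edges G. i \<in> ends G e} \<inter> {e \<in> edges G. j \<in> ends G e} = {}"
        using inj_onD[OF inj] ij(3) by blast
    qed
  qed
  ultimately show ?thesis unfolding vertex_sum_def by simp
qed

text \<open>The function \<open>g\<close> carries the merged vertex sums back to \<open>G\<close>,
  so that properness is checked on original edges and no classes have to be compared.\<close>

lemma local_antimagic_mergeI:
  assumes G: "simple_graph G" and f: "bij_betw f (edges G) {1..card (edges G)}"
    and g: "\<And>x. x \<in> verts G \<Longrightarrow> vertex_sum (merge P G) f (merge_class P x) = g x"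
    and proper: "\<And>e x y. e \<in> edges G \<Longrightarrow> ends G e = {x, y} \<Longrightarrow> g x \<noteq> g y"
  shows "local_antimagic (merge P G) f"
  unfolding local_antimagic_def
proof (intro conjI ballI allI impI)
  show "bij_betw f (edges (merge P G)) {1..card (edges (merge P G))}"
    using f by (simp add: merge_def)
  fix e u v assume "e \<in> edges (merge P G)" and uv: "ends (merge P G) e = {u, v}"
  then have e: "e \<in> edges G" by (simp add: merge_def)
  then obtain x y where xy: "ends G e = {x, y}" "x \<in> verts G" "y \<in> verts G"
    using G unfolding simple_graph_def card_2_iff by (metis insert_subset)
  have "g x \<noteq> g y" by (rule proper[OF e xy(1)])
  moreover have "{merge_class P x, merge_class P y} = {u, v}"
    using uv xy(1) by (simp add: merge_def)
  ultimately show "vertex_sum (merge P G) f u \<noteq> vertex_sum (merge P G) f v"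
    using g xy(2,3) by (metis doubleton_eq_iff)
qed

section \<open>The lower bound from a map exchanging the colour classes\<close>

text \<open>
  With two colours every edge meets each colour class exactly once, so the vertex sums over each
  class add up to the sum of all labels.  If \<open>\<phi>\<close> exchanges the classes, they have equal size, and
  hence the two colours coincide.
\<close>

lemma local_antimagic_card_ge_3:
  assumes G: "simple_graph G" and ne: "edges G \<noteq> {}"
    and \<phi>: "bij_betw \<phi> (verts G) (verts G)"
    and flip: "\<And>c x. x \<in> verts G \<Longrightarrow>
      (\<And>e u v. e \<in> edges G \<Longrightarrow> ends G e = {u, v} \<Longrightarrow> c u \<noteq> (c v :: bool)) \<Longrightarrow> c (\<phi> x) \<noteq> c x"
    and f: "local_antimagic G f"
  shows "3 \<le> card (vertex_sum G f ` verts G)"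
proof (rule ccontr)
  let ?w = "vertex_sum G f"
  assume "\<not> 3 \<le> card (?w ` verts G)"
  then have le: "card (?w ` verts G) \<le> 2" by simp
  have fin: "finite (verts G)" "finite (edges G)" using G unfolding simple_graph_def by auto
  have ends: "\<exists>x y. ends G e = {x, y} \<and> x \<noteq> y \<and> x \<in> verts G \<and> y \<in> verts G"
    if "e \<in> edges G" for e
    using G that unfolding simple_graph_def card_2_iff by (metis insert_subset)
  have neq: "?w x \<noteq> ?w y" if "e \<in> edges G" "ends G e = {x, y}" for e x y
    using f that unfolding local_antimagic_def by blast
  obtain e0 where e0: "e0 \<in> edges G" using ne by blast
  then obtain a b where ab: "ends G e0 = {a, b}" "a \<in> verts G" "b \<in> verts G" using ends by blast
  define p q where "p = ?w a" and "q = ?w b"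
  have pq: "p \<noteq> q" unfolding p_def q_def by (rule neq[OF e0 ab(1)])
  have "{p, q} \<subseteq> ?w ` verts G" using ab unfolding p_def q_def by blast
  then have two: "?w ` verts G = {p, q}"
    using le pq fin by (metis card_2_iff card_seteq finite_imageI)
  have cls: "(\<Sum>x | x \<in> verts G \<and> ?w x = t. ?w x) = sum f (edges G)" if t: "t \<in> {p, q}" for t
  proof -
    let ?X = "{x \<in> verts G. ?w x = t}"
    have one: "card {x \<in> ?X. x \<in> ends G e} = 1" if e: "e \<in> edges G" for e
    proof -
      obtain x y where xy: "ends G e = {x, y}" "x \<in> verts G" "y \<in> verts G" using ends[OF e] by blast
      have "?w x \<noteq> ?w y" by (rule neq[OF e xy(1)])
      moreover have "?w x \<in> {p, q}" "?w y \<in> {p, q}" using two xy by blast+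
      ultimately have "{z \<in> ?X. z \<in> ends G e} = {x} \<or> {z \<in> ?X. z \<in> ends G e} = {y}"
        using t xy by auto
      then show ?thesis by auto
    qed
    have "(\<Sum>x\<in>?X. ?w x) = (\<Sum>x\<in>?X. \<Sum>e\<in>edges G. if x \<in> ends G e then f e else 0)"
      unfolding vertex_sum_def by (rule sum.cong[OF refl]) (use fin in \<open>simp add: sum.inter_filter\<close>)
    also have "\<dots> = (\<Sum>e\<in>edges G. \<Sum>x\<in>?X. if x \<in> ends G e then f e else 0)" by (rule sum.swap)
    also have "\<dots> = (\<Sum>e\<in>edges G. card {x \<in> ?X. x \<in> ends G e} * f e)"
    proof (rule sum.cong[OF refl])
      fix e
      have "finite ?X" using fin by simp
      then show "(\<Sum>x\<in>?X. if x \<in> ends G e then f e else 0) = card {x \<in> ?X. x \<in> ends G e} * f e"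
        by (simp add: sum.inter_filter[symmetric])
    qed
    also have "\<dots> = sum f (edges G)" using one by (intro sum.cong) auto
    finally show ?thesis .
  qed
  let ?A = "{x \<in> verts G. ?w x = p}" and ?B = "{x \<in> verts G. ?w x = q}"
  \<comment> \<open>With only the values \<open>p\<close> and \<open>q\<close> present, "has vertex
    sum \<open>p\<close>" is a proper boolean colouring, to which \<open>flip\<close>
    applies.\<close>
  have fl: "(?w (\<phi> x) = p) \<noteq> (?w x = p)" if "x \<in> verts G" for x
  proof (rule flip[OF that])
    fix e u v assume e: "e \<in> edges G" "ends G e = {u, v}"
    then have "{u, v} \<subseteq> verts G" using G unfolding simple_graph_def by metis
    then have "?w u \<in> {p, q}" "?w v \<in> {p, q}" using two by blast+
    then show "(?w u = p) \<noteq> (?w v = p)" using neq[OF e] by auto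
  qed
  have w: "?w x = q \<longleftrightarrow> ?w x \<noteq> p" if "x \<in> verts G" for x
    using two that pq by blast
  have \<phi>V: "\<phi> x \<in> verts G" if "x \<in> verts G" for x using \<phi> that by (rule bij_betwE[THEN bspec])
  have "\<phi> ` ?A = ?B"
  proof
    show "\<phi> ` ?A \<subseteq> ?B" using fl w \<phi>V by auto
    show "?B \<subseteq> \<phi> ` ?A"
    proof
      fix y assume y: "y \<in> ?B"
      then obtain x where x: "x \<in> verts G" "y = \<phi> x" using \<phi> unfolding bij_betw_def by blast
      then have "x \<in> ?A" using fl[OF x(1)] w[OF \<phi>V[OF x(1)]] y by simp
      then show "y \<in> \<phi> ` ?A" using x(2) by (rule image_eqI[rotated])
    qed
  qed
  moreover have "inj_on \<phi> ?A"
    using bij_betw_imp_inj_on[OF \<phi>] by (rule inj_on_subset) auto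
  ultimately have card: "card ?A = card ?B" using card_image[of \<phi> ?A] by simp
  have "card ?A * p = card ?B * q"
    using cls[of p] cls[of q] by simp
  \<comment> \<open>A nonempty class lets the common cardinality be cancelled, giving
    \<open>p = q\<close>.\<close>
  moreover have "a \<in> ?A" using ab unfolding p_def by simp
  then have "card ?A \<noteq> 0" using fin by auto
  ultimately show False using pq card by simp
qed

lemma chromatic_number_eq_3I:
  assumes "\<And>f. local_antimagic G f \<Longrightarrow> 3 \<le> card (vertex_sum G f ` verts G)"
    and "local_antimagic G f" "card (vertex_sum G f ` verts G) \<le> 3"
  shows "\<chi>\<^sub>l\<^sub>a G = 3"
  unfolding local_antimagic_chromatic_number_def
proof (rule antisym)
  have "(INF f \<in> {f. local_antimagic G f}. enat (card (vertex_sum G f ` verts G)))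
      \<le> enat (card (vertex_sum G f ` verts G))"
    using assms(2) by (intro INF_lower) simp
  also have "\<dots> \<le> 3" using assms(3) by (simp add: numeral_eq_enat)
  finally show "(INF f \<in> {f. local_antimagic G f}. enat (card (vertex_sum G f ` verts G))) \<le> 3" .
  show "3 \<le> (INF f \<in> {f. local_antimagic G f}. enat (card (vertex_sum G f ` verts G)))"
    using assms(1) by (intro INF_greatest) (simp add: numeral_eq_enat)
qed

section \<open>A labeling of the disjoint copies\<close>

text \<open>Numbers the 20 edges of a copy: first the u-cycle, then the v-cycle, then the four
  rungs. A labeling thereby becomes a table indexed by copy and position.\<close>

definition edge_at :: "nat \<Rightarrow> nat \<Rightarrow> vertex set" where
  "edge_at a k =
     (if k \<le> 8 then {U a k, U a (succ8 k)}
      else if k \<le> 16 then {V a (k - 8), V a (succ8 (k - 8))}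
      else {U a (2 * (k - 16)), V a (2 * (k - 16))})"

text \<open>
  The two edges at a vertex of odd index get labels adding up to $20n+1$.  As \<open>a\<close> runs through
  $1, \dots, n$, each edge fills an interval of $n$ labels or every second label of an interval of
  $2n$ labels.  The edges of the latter kind pair up: positions 3 and 7, 10 and 14, 11 and 15, and
  2 and 6 of the list together fill an interval of $2n$ labels each.
\<close>

definition label :: "nat \<Rightarrow> nat \<Rightarrow> nat \<Rightarrow> nat" where
  "label n a k =
     [a, 14 * n + 1 - 2 * a, 6 * n + 2 * a, 6 * n + 1 - a,
      14 * n + a, 14 * n + 2 - 2 * a, 6 * n + 2 * a - 1, 20 * n + 1 - a,
      4 * n + a, 10 * n + 2 - 2 * a, 10 * n + 2 * a - 1, 2 * n + 1 - a,
      18 * n + a, 10 * n + 1 - 2 * a, 10 * n + 2 * a, 16 * n + 1 - a,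
      16 * n + a, 18 * n + 1 - a, 2 * n + a, 4 * n + 1 - a] ! (k - 1)"

lemma upto_8: "{1..8::nat} = {1, 2, 3, 4, 5, 6, 7, 8}"
  by auto

lemma upto_20:
  "{1..20::nat} = {1, 2, 3, 4, 5, 6, 7, 8, 9, 10, 11, 12, 13, 14, 15, 16, 17, 18, 19, 20}"
  by (simp add: numeral_eq_Suc atLeastAtMostSuc_conv insert_commute)

text \<open>The labels are cut into 20 blocks of length \<open>n\<close>; the block containing a
  label determines the position, for the middle blocks together with the parity of the label.
  Solving for the copy then gives an explicit preimage.\<close>

lemma label_surj: "{1..20 * n} \<subseteq> (\<lambda>(a, k). label n a k) ` ({1..n} \<times> {1..20})"
  (is "_ \<subseteq> ?R")
proof
  fix t assume "t \<in> {1..20 * n}"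
  then have t1: "1 \<le> t" "t - 1 < 20 * n" and n: "0 < n" by auto
  \<comment> \<open>Labels and copies start at 1, hence the shift: \<open>q\<close> is the block
    counted from 0, and \<open>a\<close> is the place inside it counted from 1.\<close>
  define q a where "q = (t - 1) div n" and "a = (t - 1) mod n + 1"
  have t: "t = q * n + a" using t1 unfolding q_def a_def by (simp add: add.assoc[symmetric])
  have a: "1 \<le> a" "a \<le> n" using n unfolding a_def by (simp_all add: Suc_le_eq)
  have "q < 20" using t1 unfolding q_def by (intro less_mult_imp_div_less)
  then have "q + 1 \<in> {1..20}" by simp
  then have q: "q \<in> {0, 1, 2, 3, 4, 5, 6, 7, 8, 9, 10, 11, 12, 13, 14, 15, 16, 17, 18, 19}"
    unfolding upto_20 by simp
  \<comment> \<open>The parity of \<open>t\<close> decides between the two positions that interleave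
    in blocks 6 to 13.\<close>
  obtain h where h: "t = 2 * h \<or> t + 1 = 2 * h"
    by (metis evenE even_plus_one_iff)
  have *: "t \<in> ?R" if "a \<in> {1..n}" "k \<in> {1..20}" "label n a k = t" for a k
    using that by force
  show "t \<in> ?R"
    using q
  proof (elim insertE emptyE)
    \<comment> \<open>In blocks 0 to 5 and 14 to 19 a single position fills the block: the copy is
      \<open>a\<close> if its labels increase with the copy, and \<open>n + 1 - a\<close> if they
      decrease.\<close>
    assume "q = 0"
    then show "t \<in> ?R" using a t by (intro *[of "a" 1]) (auto simp: label_def)
  next
    assume "q = 1"
    then show "t \<in> ?R" using a t by (intro *[of "n + 1 - a" 12]) (auto simp: label_def)
  next
    assume "q = 2"
    then show "t \<in> ?R" using a t by (intro *[of "a" 19]) (auto simp: label_def)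
  next
    assume "q = 3"
    then show "t \<in> ?R" using a t by (intro *[of "n + 1 - a" 20]) (auto simp: label_def)
  next
    assume "q = 4"
    then show "t \<in> ?R" using a t by (intro *[of "a" 9]) (auto simp: label_def)
  next
    assume "q = 5"
    then show "t \<in> ?R" using a t by (intro *[of "n + 1 - a" 4]) (auto simp: label_def)
  next
    \<comment> \<open>Blocks 6 and 7 share positions 3 (even labels) and 7 (odd labels). Solving
      \<open>6 * n + 2 * a = 2 * h\<close> gives copy \<open>h - 3 * n\<close> in both cases; the
      pairs of blocks up to 13 are handled likewise.\<close>
    assume q: "q = 6"
    show "t \<in> ?R"
      using h
    proof
      assume "t = 2 * h"
      then show ?thesis using q a t by (intro *[of "h - 3 * n" 3]) (auto simp: label_def)
    next
      assume "t + 1 = 2 * h"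
      then show ?thesis using q a t by (intro *[of "h - 3 * n" 7]) (auto simp: label_def)
    qed
  next
    assume q: "q = 7"
    show "t \<in> ?R"
      using h
    proof
      assume "t = 2 * h"
      then show ?thesis using q a t by (intro *[of "h - 3 * n" 3]) (auto simp: label_def)
    next
      assume "t + 1 = 2 * h"
      then show ?thesis using q a t by (intro *[of "h - 3 * n" 7]) (auto simp: label_def)
    qed
  next
    assume q: "q = 8"
    show "t \<in> ?R"
      using h
    proof
      assume "t = 2 * h"
      then show ?thesis using q a t by (intro *[of "5 * n + 1 - h" 10]) (auto simp: label_def)
    next
      assume "t + 1 = 2 * h"
      then show ?thesis using q a t by (intro *[of "5 * n + 1 - h" 14]) (auto simp: label_def)
    qed
  next
    assume q: "q = 9"
    show "t \<in> ?R"
      using h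
    proof
      assume "t = 2 * h"
      then show ?thesis using q a t by (intro *[of "5 * n + 1 - h" 10]) (auto simp: label_def)
    next
      assume "t + 1 = 2 * h"
      then show ?thesis using q a t by (intro *[of "5 * n + 1 - h" 14]) (auto simp: label_def)
    qed
  next
    assume q: "q = 10"
    show "t \<in> ?R"
      using h
    proof
      assume "t = 2 * h"
      then show ?thesis using q a t by (intro *[of "h - 5 * n" 15]) (auto simp: label_def)
    next
      assume "t + 1 = 2 * h"
      then show ?thesis using q a t by (intro *[of "h - 5 * n" 11]) (auto simp: label_def)
    qed
  next
    assume q: "q = 11"
    show "t \<in> ?R"
      using h
    proof
      assume "t = 2 * h"
      then show ?thesis using q a t by (intro *[of "h - 5 * n" 15]) (auto simp: label_def)
    next
      assume "t + 1 = 2 * h"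
      then show ?thesis using q a t by (intro *[of "h - 5 * n" 11]) (auto simp: label_def)
    qed
  next
    assume q: "q = 12"
    show "t \<in> ?R"
      using h
    proof
      assume "t = 2 * h"
      then show ?thesis using q a t by (intro *[of "7 * n + 1 - h" 6]) (auto simp: label_def)
    next
      assume "t + 1 = 2 * h"
      then show ?thesis using q a t by (intro *[of "7 * n + 1 - h" 2]) (auto simp: label_def)
    qed
  next
    assume q: "q = 13"
    show "t \<in> ?R"
      using h
    proof
      assume "t = 2 * h"
      then show ?thesis using q a t by (intro *[of "7 * n + 1 - h" 6]) (auto simp: label_def)
    next
      assume "t + 1 = 2 * h"
      then show ?thesis using q a t by (intro *[of "7 * n + 1 - h" 2]) (auto simp: label_def)
    qed
  next
    assume "q = 14"
    then show "t \<in> ?R" using a t by (intro *[of "a" 5]) (auto simp: label_def)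
  next
    assume "q = 15"
    then show "t \<in> ?R" using a t by (intro *[of "n + 1 - a" 16]) (auto simp: label_def)
  next
    assume "q = 16"
    then show "t \<in> ?R" using a t by (intro *[of "a" 17]) (auto simp: label_def)
  next
    assume "q = 17"
    then show "t \<in> ?R" using a t by (intro *[of "n + 1 - a" 18]) (auto simp: label_def)
  next
    assume "q = 18"
    then show "t \<in> ?R" using a t by (intro *[of "a" 13]) (auto simp: label_def)
  next
    assume "q = 19"
    then show "t \<in> ?R" using a t by (intro *[of "n + 1 - a" 8]) (auto simp: label_def)
  qed
qed

text \<open>Index set and label set both have \<open>20 * n\<close> elements, so surjectivity
  already yields injectivity.\<close>

lemma bij_label: "bij_betw (\<lambda>(a, k). label n a k) ({1..n} \<times> {1..20}) {1..20 * n}"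
proof -
  let ?L = "\<lambda>(a, k). label n a k" and ?I = "{1..n} \<times> {1..20::nat}"
  have c: "card ?I = 20 * n" by (simp add: card_cartesian_product)
  have "card (?L ` ?I) \<le> card ?I" by (intro card_image_le) simp
  then have eq: "{1..20 * n} = ?L ` ?I"
    using label_surj c by (intro card_seteq) auto
  then have "card (?L ` ?I) = card ?I" using c by (metis card_atLeastAtMost diff_Suc_1)
  then have "inj_on ?L ?I" by (intro eq_card_imp_inj_on) simp
  then show ?thesis unfolding bij_betw_def using eq by simp
qed

lemma bij_edge_at: "bij_betw (\<lambda>(a, k). edge_at a k) ({1..n} \<times> {1..20}) (edges (copies_C4_8_2 n))"
  unfolding bij_betw_def
proof
  \<comment> \<open>A finite check over all pairs of positions; the copy indices stay
    symbolic.\<close>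
  have "a = b \<and> k = l" if "k \<in> {1..20}" "l \<in> {1..20}" "edge_at a k = edge_at b l" for a b k l
    using that unfolding upto_20
    by (elim insertE emptyE) (simp_all add: edge_at_def succ8_def doubleton_eq_iff)
  then show "inj_on (\<lambda>(a, k). edge_at a k) ({1..n} \<times> {1..20})"
    unfolding inj_on_def by auto
  have "e \<in> edges (copies_C4_8_2 n) \<longleftrightarrow> (\<exists>a\<in>{1..n}. \<exists>k\<in>{1..20}. e = edge_at a k)" for e
  proof
    assume "e \<in> edges (copies_C4_8_2 n)"
    then consider a i where "e = {U a i, U a (succ8 i)}" "a \<in> {1..n}" "i \<in> {1..8}"
      | a i where "e = {V a i, V a (succ8 i)}" "a \<in> {1..n}" "i \<in> {1..8}"
      | a j where "e = {U a (2 * j), V a (2 * j)}" "a \<in> {1..n}" "j \<in> {1..4}"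
      unfolding copies_edge by blast
    then show "\<exists>a\<in>{1..n}. \<exists>k\<in>{1..20}. e = edge_at a k"
    proof cases
      case (1 a i)
      then show ?thesis by - (rule bexI[of _ a], rule bexI[of _ i], auto simp: edge_at_def)
    next
      case (2 a i)
      then show ?thesis by - (rule bexI[of _ a], rule bexI[of _ "i + 8"], auto simp: edge_at_def)
    next
      case (3 a j)
      then show ?thesis by - (rule bexI[of _ a], rule bexI[of _ "j + 16"], auto simp: edge_at_def)
    qed
  next
    assume "\<exists>a\<in>{1..n}. \<exists>k\<in>{1..20}. e = edge_at a k"
    then obtain a k where a: "a \<in> {1..n}" and k: "k \<in> {1..20}" and e: "e = edge_at a k" by blast
    consider "k \<in> {1..8}" | "k - 8 \<in> {1..8}" "8 < k" | "k - 16 \<in> {1..4}" "16 < k"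
      using k by force
    then show "e \<in> edges (copies_C4_8_2 n)"
    proof cases
      case 1
      then show ?thesis using a e unfolding copies_edge edge_at_def by auto
    next
      case 2
      then have "e = {V a (k - 8), V a (succ8 (k - 8))}" using e unfolding edge_at_def by auto
      then show ?thesis using a 2 unfolding copies_edge by blast
    next
      case 3
      then have "e = {U a (2 * (k - 16)), V a (2 * (k - 16))}" using e unfolding edge_at_def by auto
      then show ?thesis using a 3 unfolding copies_edge by blast
    qed
  qed
  then show "(\<lambda>(a, k). edge_at a k) ` ({1..n} \<times> {1..20}) = edges (copies_C4_8_2 n)"
    by (auto simp: image_iff)
qed

lemma card_edges_copies: "card (edges (copies_C4_8_2 n)) = 20 * n"
  using bij_betw_same_card[OF bij_edge_at[of n]] by (simp add: card_cartesian_product)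

fun copies_sum :: "nat \<Rightarrow> vertex \<Rightarrow> nat" where
  "copies_sum n (U a i) =
     (if odd i then 20 * n + 1 else if i \<in> {2, 8} then 30 * n + 1 else 30 * n + 2)"
| "copies_sum n (V a i) =
     (if odd i then 20 * n + 1 else if i \<in> {4, 6} then 30 * n + 1 else 30 * n + 2)"

text \<open>The table \<open>label\<close> is transported to edges along \<open>edge_at\<close>.
  Only the copy of a vertex contributes to its sum, which leaves twenty conditional terms to
  evaluate for each of the 16 kinds of vertex.\<close>

lemma ex_labeling:
  obtains f where "bij_betw f (edges (copies_C4_8_2 n)) {1..card (edges (copies_C4_8_2 n))}"
    and "\<And>x. x \<in> verts (copies_C4_8_2 n) \<Longrightarrow> vertex_sum (copies_C4_8_2 n) f x = copies_sum n x"
proof -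
  let ?E = "\<lambda>(a, k). edge_at a k" and ?L = "\<lambda>(a, k). label n a k"
    and ?I = "{1..n} \<times> {1..20::nat}" and ?G = "copies_C4_8_2 n"
  define f where "f = ?L \<circ> inv_into ?I ?E"
  have "bij_betw f (edges ?G) {1..20 * n}"
    unfolding f_def using bij_betw_inv_into[OF bij_edge_at] bij_label by (rule bij_betw_trans)
  moreover have "vertex_sum ?G f x = copies_sum n x" if "x \<in> verts ?G" for x
  proof -
    have fE: "f (edge_at a k) = label n a k" if "a \<in> {1..n}" "k \<in> {1..20}" for a k
    proof -
      have "(a, k) \<in> ?I" using that by blast
      from bij_betw_inv_into_left[OF bij_edge_at this]
      show ?thesis unfolding f_def by simp
    qed
    have a: "copy_of x \<in> {1..n}" using that by (cases x) (auto simp: copies_verts)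
    have copy: "a = copy_of x" if "x \<in> edge_at a k" for a k
      using that by (auto simp: edge_at_def split: if_splits)
    \<comment> \<open>A conditional sum over all edges, unlike a sum over incident edges, can be
      reindexed by copy and position.\<close>
    have "vertex_sum ?G f x = (\<Sum>e\<in>edges ?G. if x \<in> e then f e else 0)"
      unfolding vertex_sum_def copies_ends
      using simple_graph_copies by (simp add: sum.inter_filter simple_graph_def)
    also have "\<dots> = (\<Sum>(a, k)\<in>?I. if x \<in> edge_at a k then f (edge_at a k) else 0)"
      by (subst sum.reindex_bij_betw[OF bij_edge_at, symmetric])
        (intro sum.cong refl, simp add: split_beta)
    also have "\<dots> = (\<Sum>a\<in>{1..n}. \<Sum>k\<in>{1..20}. if x \<in> edge_at a k then f (edge_at a k) else 0)"
      by (simp add: sum.cartesian_product)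
    also have "\<dots> = (\<Sum>a\<in>{1..n}. if copy_of x = a
        then \<Sum>k\<in>{1..20}. if x \<in> edge_at a k then label n a k else 0 else 0)"
    proof (rule sum.cong[OF refl])
      fix a assume a: "a \<in> {1..n}"
      show "(\<Sum>k\<in>{1..20}. if x \<in> edge_at a k then f (edge_at a k) else 0) = (if copy_of x = a
        then \<Sum>k\<in>{1..20}. if x \<in> edge_at a k then label n a k else 0 else 0)"
      proof (cases "copy_of x = a")
        case True
        then show ?thesis using fE[OF a] by (auto intro!: sum.cong)
      next
        case False
        then have "x \<notin> edge_at a k" for k using copy by blast
        then show ?thesis using False by simp
      qed
    qed
    also have "\<dots> = (\<Sum>k\<in>{1..20}. if x \<in> edge_at (copy_of x) k then label n (copy_of x) k else 0)"
      using a by simp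
    also have "\<dots> = copies_sum n x"
    proof (cases x)
      case (U a i)
      then have "a \<in> {1..n}" "i \<in> {1..8}" using that by (auto simp: copies_verts)
      \<comment> \<open>The bound \<open>a \<le> n\<close> makes every truncated subtraction in the
        labels exact.\<close>
      then show ?thesis unfolding U upto_8 upto_20
        by (elim insertE emptyE) (simp_all add: edge_at_def succ8_def label_def)
    next
      case (V a i)
      then have "a \<in> {1..n}" "i \<in> {1..8}" using that by (auto simp: copies_verts)
      then show ?thesis unfolding V upto_8 upto_20
        by (elim insertE emptyE) (simp_all add: edge_at_def succ8_def label_def)
    qed
    finally show ?thesis .
  qed
  ultimately show thesis using that card_edges_copies by simp
qed


section \<open>Exchanging the two cycles of each copy\<close>

text \<open>Colours alternate along each cycle, so on either side the colour depends only on the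
  parity of the index; a single rung then shows that the two sides alternate oppositely.\<close>

lemma copies_flip:
  fixes c :: "vertex \<Rightarrow> bool"
  assumes proper: "\<And>e x y. e \<in> edges (copies_C4_8_2 n) \<Longrightarrow>
      ends (copies_C4_8_2 n) e = {x, y} \<Longrightarrow> c x \<noteq> c y"
    and a: "a \<in> {1..n}" and "i \<in> {1..8}" "j \<in> {1..8}" "even i \<longleftrightarrow> even j"
  shows "c (U a i) \<noteq> c (V a j)"
proof -
  have U: "c (U a i) \<noteq> c (U a (succ8 i))" and V: "c (V a i) \<noteq> c (V a (succ8 i))"
    if "i \<in> {1..8}" for i
    using that a unfolding copies_edge
    by (blast intro!: proper[OF _ copies_ends] iffD2[OF copies_edge])+
  have UV: "c (U a 2) \<noteq> c (V a 2)"
  proof (rule proper[OF _ copies_ends])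
    have "{U a (2 * 1), V a (2 * 1)} \<in> edges (copies_C4_8_2 n)"
      using a by (intro iffD2[OF copies_edge] disjI2 exI conjI refl) auto
    then show "{U a 2, V a 2} \<in> edges (copies_C4_8_2 n)" by simp
  qed
  have S: "succ8 1 = 2" "succ8 2 = 3" "succ8 3 = 4" "succ8 4 = 5" "succ8 5 = 6" "succ8 6 = 7"
    "succ8 7 = 8"
    by (simp_all add: succ8_def)
  note chainU = U[of 1] U[of 2] U[of 3] U[of 4] U[of 5] U[of 6] U[of 7]
  note chainV = V[of 1] V[of 2] V[of 3] V[of 4] V[of 5] V[of 6] V[of 7]
  \<comment> \<open>The path through the indices 1 to 8 relates every index to index 2, where the
    chosen rung is attached.\<close>
  have "c (U a i) \<longleftrightarrow> (c (U a 2) = even i)"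
    using chainU \<open>i \<in> _\<close> unfolding S upto_8 by (elim insertE emptyE) simp_all
  moreover have "c (V a j) \<longleftrightarrow> (c (V a 2) = even j)"
    using chainV \<open>j \<in> _\<close> unfolding S upto_8 by (elim insertE emptyE) simp_all
  ultimately show ?thesis using UV assms(5) by blast
qed

fun swap :: "(nat \<Rightarrow> nat) \<Rightarrow> vertex \<Rightarrow> vertex" where
  "swap \<pi> (U a i) = V a (\<pi> i)"
| "swap \<pi> (V a i) = U a (\<pi> i)"

text \<open>An involution that maps \<open>P\<close> into itself permutes \<open>P\<close>, so it
  carries the sets containing \<open>x\<close> exactly to those containing its image. It therefore
  acts on merged vertices.\<close>

lemma merge_class_image:
  assumes inv: "\<And>x. \<sigma> (\<sigma> x) = x" and P: "\<And>X. X \<in> P \<Longrightarrow> \<sigma> ` X \<in> P"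
  shows "merge_class P (\<sigma> x) = \<sigma> ` merge_class P x"
proof -
  have ii: "\<sigma> ` \<sigma> ` X = X" for X using inv by (simp add: image_image)
  have "{X \<in> P. \<sigma> x \<in> X} = (\<lambda>X. \<sigma> ` X) ` {X \<in> P. x \<in> X}"
  proof (rule set_eqI)
    fix X
    show "X \<in> {X \<in> P. \<sigma> x \<in> X} \<longleftrightarrow> X \<in> (\<lambda>X. \<sigma> ` X) ` {X \<in> P. x \<in> X}"
    proof
      assume "X \<in> {X \<in> P. \<sigma> x \<in> X}"
      then have "\<sigma> ` X \<in> P" "x \<in> \<sigma> ` X" using P inv by (auto simp: image_iff) metis
      then show "X \<in> (\<lambda>X. \<sigma> ` X) ` {X \<in> P. x \<in> X}"
        using ii[of X] by (intro image_eqI[of _ _ "\<sigma> ` X"]) auto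
    qed (use P in auto)
  qed
  then show ?thesis unfolding merge_class_def by auto
qed

text \<open>The argument common to both graphs: \<open>g\<close> predicts the merged vertex sums for
  the upper bound, and \<open>swap \<pi>\<close> exchanges the colour classes for the lower bound.
  The map has to respect the merged sets and the index parity, not adjacency.\<close>

lemma chromatic_number_merge_copies:
  fixes n s :: nat
  defines "G \<equiv> copies_C4_8_2 n"
  assumes n: "1 \<le> n"
    and disj: "disjoint P" and sub: "\<Union>P \<subseteq> verts G" and M: "simple_graph (merge P G)"
    and card: "\<And>X. X \<in> P \<Longrightarrow> card X = s"
    and const: "\<And>X x y. X \<in> P \<Longrightarrow> x \<in> X \<Longrightarrow> y \<in> X \<Longrightarrow> copies_sum n x = copies_sum n y"
    and \<pi>: "\<And>i. \<pi> (\<pi> i) = i" "\<And>i. i \<in> {1..8} \<Longrightarrow> \<pi> i \<in> {1..8}" "\<And>i. even (\<pi> i) \<longleftrightarrow> even i"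
    and P: "\<And>X. X \<in> P \<Longrightarrow> swap \<pi> ` X \<in> P"
    and g: "\<And>x. x \<in> verts G \<Longrightarrow> g x = (if x \<in> \<Union>P then s else 1) * copies_sum n x"
    and proper: "\<And>e x y. e \<in> edges G \<Longrightarrow> ends G e = {x, y} \<Longrightarrow> g x \<noteq> g y"
    and g3: "card (g ` verts G) \<le> 3"
  shows "\<chi>\<^sub>l\<^sub>a (merge P G) = 3"
proof -
  have G: "simple_graph G" unfolding G_def by (rule simple_graph_copies)
  obtain f where f: "bij_betw f (edges G) {1..card (edges G)}"
    and sum: "\<And>x. x \<in> verts G \<Longrightarrow> vertex_sum G f x = copies_sum n x"
    using ex_labeling[of n] unfolding G_def by blast
  have msum: "vertex_sum (merge P G) f (merge_class P x) = g x" if x: "x \<in> verts G" for x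
  proof (cases "x \<in> \<Union>P")
    case True
    then obtain X where X: "X \<in> P" "x \<in> X" by blast
    \<comment> \<open>The \<open>s\<close> members of a merged set have equal sums, which produces
      the factor \<open>s\<close> in \<open>g\<close>.\<close>
    have "(\<Sum>y\<in>X. vertex_sum G f y) = (\<Sum>y\<in>X. copies_sum n x)"
    proof (rule sum.cong[OF refl])
      fix y assume y: "y \<in> X"
      then have "y \<in> verts G" using X sub by blast
      then show "vertex_sum G f y = copies_sum n x" using sum const[OF X(1) y X(2)] by simp
    qed
    then show ?thesis
      using vertex_sum_merge[OF disj sub x G M] merge_class_in[OF disj X] True g[OF x] card[OF X(1)]
      by simp
  next
    case False
    then show ?thesis
      using vertex_sum_merge[OF disj sub x G M] merge_class_notin[OF False] g[OF x] sum[OF x] by simp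
  qed
  let ?\<sigma> = "swap \<pi>"
  have inv: "?\<sigma> (?\<sigma> x) = x" for x by (cases x) (simp_all add: \<pi>)
  have V: "?\<sigma> x \<in> verts G" if "x \<in> verts G" for x
    using that \<pi>(2) unfolding G_def by (cases x) (simp_all add: copies_verts del: atLeastAtMost_iff)
  have cls: "merge_class P (?\<sigma> x) = ?\<sigma> ` merge_class P x" for x
    by (rule merge_class_image[OF inv P])
  show ?thesis
  proof (rule chromatic_number_eq_3I)
    show "local_antimagic (merge P G) f"
      by (rule local_antimagic_mergeI[OF G f msum proper])
    have "vertex_sum (merge P G) f ` verts (merge P G) = g ` verts G"
      unfolding merge_def graph.simps image_image using msum unfolding merge_def
      by (intro image_cong refl) simp
    then show "card (vertex_sum (merge P G) f ` verts (merge P G)) \<le> 3" using g3 by simp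
  next
    fix f assume f: "local_antimagic (merge P G) f"
    show "3 \<le> card (vertex_sum (merge P G) f ` verts (merge P G))"
    proof (rule local_antimagic_card_ge_3[OF M _ _ _ f])
      have "(1, 1) \<in> {1..n} \<times> {1..20::nat}" using n by simp
      then have "(case (1, 1) of (a, k) \<Rightarrow> edge_at a k) \<in> edges G"
        using bij_edge_at unfolding G_def by (rule bij_betwE[THEN bspec, rotated])
      then show "edges (merge P G) \<noteq> {}" unfolding merge_def by auto
      have "(\<lambda>X. ?\<sigma> ` X) ` verts (merge P G) \<subseteq> verts (merge P G)"
        unfolding merge_def using V by (auto simp: cls[symmetric])
      \<comment> \<open>The induced map on classes is its own inverse.\<close>
      then show "bij_betw (\<lambda>X. ?\<sigma> ` X) (verts (merge P G)) (verts (merge P G))"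
        by (intro bij_betw_byWitness[where f' = "\<lambda>X. ?\<sigma> ` X"]) (simp_all add: image_image inv)
    next
      fix c :: "vertex set \<Rightarrow> bool" and X
      assume X: "X \<in> verts (merge P G)"
        and c: "\<And>e u v. e \<in> edges (merge P G) \<Longrightarrow> ends (merge P G) e = {u, v} \<Longrightarrow> c u \<noteq> c v"
      let ?c = "\<lambda>x. c (merge_class P x)"
      obtain x where x: "x \<in> verts G" "X = merge_class P x" using X unfolding merge_def by auto
      \<comment> \<open>The colouring pulls back to the unmerged copies, where
        \<open>copies_flip\<close> applies.\<close>
      have proper: "?c x \<noteq> ?c y" if "e \<in> edges G" "ends G e = {x, y}" for e x y
        using that by (intro c[of e]) (simp_all add: merge_def)
      have fl: "?c (U a i) \<noteq> ?c (V a j)"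
        if "a \<in> {1..n}" "i \<in> {1..8}" "j \<in> {1..8}" "even i \<longleftrightarrow> even j" for a i j
        using proper that unfolding G_def by (rule copies_flip)
      have "?c (?\<sigma> x) \<noteq> ?c x"
      proof (cases x)
        case (U a i)
        then have "a \<in> {1..n}" "i \<in> {1..8}"
          using x(1) unfolding G_def by (simp_all add: copies_verts)
        then show ?thesis using fl[of a i "\<pi> i"] \<pi>(2,3) U by auto
      next
        case (V a i)
        then have "a \<in> {1..n}" "i \<in> {1..8}"
          using x(1) unfolding G_def by (simp_all add: copies_verts)
        then show ?thesis using fl[of a "\<pi> i" i] \<pi>(2,3) V by auto
      qed
      then show "c (?\<sigma> ` X) \<noteq> c X" using x(2) by (simp add: cls)
    qed
  qed
qed

section \<open>Blocks and the two families of merged sets\<close>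

lemma card_block: "card (U_block s b k) = s" "card (V_block s b k) = s"
proof -
  have "U_block s b k = (\<lambda>i. U ((b - 1) * s + i) k) ` {1..s}"
    "V_block s b k = (\<lambda>i. V ((b - 1) * s + i) k) ` {1..s}"
    unfolding U_block_def V_block_def by auto
  then show "card (U_block s b k) = s" "card (V_block s b k) = s"
    by (simp_all add: card_image inj_on_def)
qed

lemma ex_block:
  assumes "a \<in> {1..r * s}"
  obtains b where "b \<in> {1..r}" "U a k \<in> U_block s b k" "V a k \<in> V_block s b k"
proof
  have s: "0 < s" using assms by (cases s) auto
  have "a - 1 < r * s" using assms by auto
  \<comment> \<open>Copies and blocks are numbered from 1, so \<open>a - 1\<close> is divided by
    \<open>s\<close> and the quotient shifted back.\<close>
  then show "(a - 1) div s + 1 \<in> {1..r}" using s by (simp add: less_mult_imp_div_less Suc_le_eq)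
  have "a = ((a - 1) div s + 1 - 1) * s + ((a - 1) mod s + 1)"
    using assms by (simp add: add.assoc[symmetric])
  moreover have "(a - 1) mod s + 1 \<in> {1..s}" using s by (simp add: Suc_le_eq)
  ultimately show "U a k \<in> U_block s ((a - 1) div s + 1) k"
    "V a k \<in> V_block s ((a - 1) div s + 1) k"
    unfolding U_block_def V_block_def by blast+
qed

lemma swap_block: "swap \<pi> ` U_block s b k = V_block s b (\<pi> k)"
  "swap \<pi> ` V_block s b k = U_block s b (\<pi> k)"
  unfolding U_block_def V_block_def by force+

text \<open>With the indices listed explicitly, membership and invariance under \<open>swap\<close>
  become finite checks.\<close>

lemma merged_sets1_eq: "merged_sets1 r s = {U_block s b k | b k. b \<in> {1..r} \<and> k \<in> {1, 3, 5, 7}}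
    \<union> {V_block s b k | b k. b \<in> {1..r} \<and> k \<in> {1, 3, 5, 7}}"
proof -
  have j: "(\<exists>j. X = F (2 * j - 1) \<and> Q \<and> j \<in> {1..4}) \<longleftrightarrow> (\<exists>k. X = F k \<and> Q \<and> k \<in> {1, 3, 5, 7})"
    for X :: "vertex set" and F :: "nat \<Rightarrow> vertex set" and Q
  proof -
    have 4: "{1..4::nat} = {1, 2, 3, 4}" by auto
    show ?thesis unfolding 4 by (simp add: conj_disj_distribL ex_disj_distrib)
  qed
  show ?thesis
    unfolding merged_sets1_def U_block_def[symmetric] V_block_def[symmetric] j ..
qed

lemma merged_sets2_eq: "merged_sets2 r s = {U_block s b k | b k. b \<in> {1..r} \<and> k \<in> {2, 8}}
    \<union> {V_block s b k | b k. b \<in> {1..r} \<and> k \<in> {4, 6}}"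
proof -
  have j: "(\<exists>j. X = F (2 * j) \<and> Q \<and> j \<in> {k, l}) \<longleftrightarrow> (\<exists>i. X = F i \<and> Q \<and> i \<in> {2 * k, 2 * l})"
    for X :: "vertex set" and F :: "nat \<Rightarrow> vertex set" and Q k l
    by (simp add: conj_disj_distribL ex_disj_distrib)
  show ?thesis
    unfolding merged_sets2_def U_block_def[symmetric] V_block_def[symmetric] j by simp
qed

lemma Union_merged_sets1:
  "a \<in> {1..r * s} \<Longrightarrow> i \<in> {1..8} \<Longrightarrow> U a i \<in> \<Union>(merged_sets1 r s) \<longleftrightarrow> odd i"
  "a \<in> {1..r * s} \<Longrightarrow> i \<in> {1..8} \<Longrightarrow> V a i \<in> \<Union>(merged_sets1 r s) \<longleftrightarrow> odd i"
proof -
  assume a: "a \<in> {1..r * s}" and i: "i \<in> {1..8}"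
  obtain b where b: "b \<in> {1..r}" "U a i \<in> U_block s b i" "V a i \<in> V_block s b i"
    by (rule ex_block[OF a])
  have "i \<in> {1, 3, 5, 7}" if "odd i"
    using i that unfolding upto_8 by (elim insertE emptyE) simp_all
  then have "U_block s b i \<in> merged_sets1 r s \<and> V_block s b i \<in> merged_sets1 r s" if "odd i"
    using that b(1) unfolding merged_sets1_eq by blast
  then show "U a i \<in> \<Union>(merged_sets1 r s) \<longleftrightarrow> odd i" "V a i \<in> \<Union>(merged_sets1 r s) \<longleftrightarrow> odd i"
    using b(2,3) in_merged_sets1 by blast+
qed

lemma Union_merged_sets2:
  "a \<in> {1..r * s} \<Longrightarrow> U a i \<in> \<Union>(merged_sets2 r s) \<longleftrightarrow> i \<in> {2, 8}"
  "a \<in> {1..r * s} \<Longrightarrow> V a i \<in> \<Union>(merged_sets2 r s) \<longleftrightarrow> i \<in> {4, 6}"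
proof -
  assume a: "a \<in> {1..r * s}"
  obtain b where b: "b \<in> {1..r}" "U a i \<in> U_block s b i" "V a i \<in> V_block s b i"
    by (rule ex_block[OF a])
  show "U a i \<in> \<Union>(merged_sets2 r s) \<longleftrightarrow> i \<in> {2, 8}"
  proof
    assume "i \<in> {2, 8}"
    then have "U_block s b i \<in> merged_sets2 r s" using b(1) unfolding merged_sets2_eq by blast
    then show "U a i \<in> \<Union>(merged_sets2 r s)" using b(2) by blast
  qed (auto simp: merged_sets2_eq U_block_def V_block_def)
  show "V a i \<in> \<Union>(merged_sets2 r s) \<longleftrightarrow> i \<in> {4, 6}"
  proof
    assume "i \<in> {4, 6}"
    then have "V_block s b i \<in> merged_sets2 r s" using b(1) unfolding merged_sets2_eq by blast
    then show "V a i \<in> \<Union>(merged_sets2 r s)" using b(3) by blast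
  qed (auto simp: merged_sets2_eq U_block_def V_block_def)
qed

lemma card_le_3: "A \<subseteq> {x, y, z} \<Longrightarrow> card A \<le> 3"
  by (rule order_trans[OF card_mono[of "{x, y, z}"]]) (simp_all add: card_insert_if)

section \<open>The chromatic numbers of the two graphs\<close>

lemma chromatic_number_G1:
  assumes "1 \<le> r" "2 \<le> s"
  shows "\<chi>\<^sub>l\<^sub>a (G1 r s) = 3"
proof -
  define n where "n = r * s"
  have n: "1 \<le> n" unfolding n_def using assms by simp
  \<comment> \<open>Merged vertices are recognised by their value: \<open>20 * n + 1\<close> occurs
    exactly at odd indices, as \<open>n\<close> is positive.\<close>
  define g where "g = (\<lambda>x.
    if copies_sum n x = 20 * n + 1 then s * (20 * n + 1) else copies_sum n x)"
  \<comment> \<open>Already doubling the smallest value exceeds both others, so the merged value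
    stays distinct from them.\<close>
  have big: "30 * n + 2 < s * (20 * n + 1)"
  proof -
    have "30 * n + 2 < 2 * (20 * n + 1)" using n by simp
    also have "\<dots> \<le> s * (20 * n + 1)" using assms by (intro mult_right_mono) auto
    finally show ?thesis .
  qed
  have eq: "\<chi>\<^sub>l\<^sub>a (merge (merged_sets1 r s) (copies_C4_8_2 n)) = 3"
  proof (rule chromatic_number_merge_copies[where \<pi> = id and s = s and g = g])
    show "1 \<le> n" by (rule n)
    show "disjoint (merged_sets1 r s)" by (rule disjoint_merged_sets1)
    show "\<Union>(merged_sets1 r s) \<subseteq> verts (copies_C4_8_2 n)"
      unfolding n_def by (rule merged_sets1_subset)
    show "simple_graph (merge (merged_sets1 r s) (copies_C4_8_2 n))"
      using simple_graph_G1 unfolding G1_def n_def .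
    fix X assume X: "X \<in> merged_sets1 r s"
    show "card X = s" using X unfolding merged_sets1_eq by (auto simp: card_block)
    show "swap id ` X \<in> merged_sets1 r s"
      using X unfolding merged_sets1_eq by (elim UnE CollectE exE conjE) (auto simp: swap_block)
    fix x y assume "x \<in> X" "y \<in> X"
    then show "copies_sum n x = copies_sum n y"
      using merged_sets1_cases[OF X] by (auto simp: U_block_def V_block_def)
  next
    fix x assume "x \<in> verts (copies_C4_8_2 n)"
    then show "g x = (if x \<in> \<Union>(merged_sets1 r s) then s else 1) * copies_sum n x"
      using n Union_merged_sets1[where r = r and s = s] unfolding g_def n_def[symmetric]
      by (cases x) (simp_all add: copies_verts)
  next
    fix e x y assume "e \<in> edges (copies_C4_8_2 n)" "ends (copies_C4_8_2 n) e = {x, y}"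
    \<comment> \<open>Listing the edges by position reduces properness to twenty cases.\<close>
    then have "{x, y} \<in> (\<lambda>(a, k). edge_at a k) ` ({1..n} \<times> {1..20})"
      using bij_edge_at[of n] unfolding bij_betw_def copies_ends by simp
    then obtain a k where "k \<in> {1..20}" "{x, y} = edge_at a k" by auto
    then show "g x \<noteq> g y"
      using n big unfolding upto_20 g_def
      by (elim insertE emptyE) (auto simp: edge_at_def succ8_def doubleton_eq_iff)
  next
    have "g x \<in> {s * (20 * n + 1), 30 * n + 1, 30 * n + 2}" for x
      unfolding g_def by (cases x) auto
    then show "card (g ` verts (copies_C4_8_2 n)) \<le> 3" by (intro card_le_3) blast
  qed simp_all
  then show ?thesis unfolding G1_def n_def .
qed

text \<open>
  This exchanges the merged indices of the \<open>u\<close>-side with those of the \<open>v\<close>-side.  It need not come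
  from an automorphism: only its parity matters for a 2-colouring.
\<close>

definition transpose_2_4_6_8 :: "nat \<Rightarrow> nat" where
  "transpose_2_4_6_8 i =
     (if i = 2 then 4 else if i = 4 then 2 else if i = 6 then 8 else if i = 8 then 6 else i)"

lemma chromatic_number_G2:
  assumes "1 \<le> r" "2 \<le> s"
  shows "\<chi>\<^sub>l\<^sub>a (G2 r s) = 3"
proof -
  define n where "n = r * s"
  have n: "1 \<le> n" unfolding n_def using assms by simp
  \<comment> \<open>Here the value \<open>30 * n + 1\<close> singles out the merged indices, 2 and 8
    on the u-side and 4 and 6 on the v-side.\<close>
  define g where "g = (\<lambda>x.
    if copies_sum n x = 30 * n + 1 then s * (30 * n + 1) else copies_sum n x)"
  have big: "30 * n + 2 < s * (30 * n + 1)"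
  proof -
    have "30 * n + 2 < 2 * (30 * n + 1)" using n by simp
    also have "\<dots> \<le> s * (30 * n + 1)" using assms by (intro mult_right_mono) auto
    finally show ?thesis .
  qed
  have eq: "\<chi>\<^sub>l\<^sub>a (merge (merged_sets2 r s) (copies_C4_8_2 n)) = 3"
  proof (rule chromatic_number_merge_copies[where \<pi> = transpose_2_4_6_8 and s = s and g = g])
    show "1 \<le> n" by (rule n)
    show "disjoint (merged_sets2 r s)" by (rule disjoint_merged_sets2)
    show "\<Union>(merged_sets2 r s) \<subseteq> verts (copies_C4_8_2 n)"
      unfolding n_def by (rule merged_sets2_subset)
    show "simple_graph (merge (merged_sets2 r s) (copies_C4_8_2 n))"
      using simple_graph_G2 unfolding G2_def n_def .
    fix X assume X: "X \<in> merged_sets2 r s"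
    show "card X = s" using X unfolding merged_sets2_eq by (auto simp: card_block)
    show "swap transpose_2_4_6_8 ` X \<in> merged_sets2 r s"
      using X unfolding merged_sets2_eq
      by (elim UnE CollectE exE conjE insertE emptyE) (auto simp: swap_block transpose_2_4_6_8_def)
    fix x y assume "x \<in> X" "y \<in> X"
    then show "copies_sum n x = copies_sum n y"
      using merged_sets2_cases[OF X] by (auto simp: U_block_def V_block_def)
  next
    fix x assume "x \<in> verts (copies_C4_8_2 n)"
    then show "g x = (if x \<in> \<Union>(merged_sets2 r s) then s else 1) * copies_sum n x"
      using n Union_merged_sets2[where r = r and s = s] unfolding g_def n_def[symmetric]
      by (cases x) (auto simp: copies_verts)
  next
    fix e x y assume "e \<in> edges (copies_C4_8_2 n)" "ends (copies_C4_8_2 n) e = {x, y}"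
    then have "{x, y} \<in> (\<lambda>(a, k). edge_at a k) ` ({1..n} \<times> {1..20})"
      using bij_edge_at[of n] unfolding bij_betw_def copies_ends by simp
    then obtain a k where "k \<in> {1..20}" "{x, y} = edge_at a k" by auto
    then show "g x \<noteq> g y"
      using n big unfolding upto_20 g_def
      by (elim insertE emptyE) (auto simp: edge_at_def succ8_def doubleton_eq_iff)
  next
    have "g x \<in> {20 * n + 1, s * (30 * n + 1), 30 * n + 2}" for x
      unfolding g_def by (cases x) auto
    then show "card (g ` verts (copies_C4_8_2 n)) \<le> 3" by (intro card_le_3) blast
  qed (auto simp: transpose_2_4_6_8_def)
  then show ?thesis unfolding G2_def n_def .
qed

theorem theorem3p3:
  fixes r s :: nat
  assumes "r \<ge> 1" and "s \<ge> 2"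
  shows "\<chi>\<^sub>l\<^sub>a (G1 r s) = 3 \<and> \<chi>\<^sub>l\<^sub>a (G2 r s) = 3"
  using chromatic_number_G1[OF assms] chromatic_number_G2[OF assms] by simp

end
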